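(* Let $Q\in(0,1)$ and let $T_Q=\inf\{n\in\mathbb{N}_0:\ \pi_{n,0}\le Q\}$. Then the false alarm probability of $T_Q$ satisfies $$\mathrm{PFA}(T_Q)=\mathbb{P}(T_Q<t)\le Q.$$
   Context: Notation: $\mathbb{N}_0=\{0,1,2,\dots\}$, $\mathbb{N}=\{1,2,\dots\}$. Model. Let $\mathcal{S}\subset\mathbb{R}^2$ be a domain and $\mathcal{O}=\{o_0,\dots,o_{M-1}\}\subset\mathcal{S}$ a finite set of $M$ possible source locations. The source location $O$ is uniform on $\mathcal{O}$. The change point $t$ is independent of $O$ and geometric with parameter $\rho\in(0,1)$: $\mathbb{P}(t=m)=\rho(1-\rho)^m$, $m\in\mathbb{N}_0$. Let $R_n$ be the integer radius of the event at time $n$, with values in $\{0,1,\dots,\mathfrak{R}\}$, where $\mathfrak{R}\in\mathbb{N}$ is the smallest radius covering all of $\mathcal{S}$ from any source in $\mathcal{O}$. We have $R_n=0$ for $n<t$ and $R_t=1$; thereafter, with $\rho_1\in(0,1]$ fixed, $\mathbb{P}(R_n=r+1\mid R_{n-1}=r)=\rho_1=1-\mathbb{P}(R_n=r\mid R_{n-1}=r)$ for $1\le r<\mathfrak{R}$, and $R_n=\mathfrak{R}$ once $R_{n-1}=\mathfrak{R}$. The radius process is Markov and independent of $O$. Observations. At each time $n\in\mathbb{N}$ there is a known deterministic finite set $\mathcal{A}_n\subset\mathcal{S}$ of sensor locations, and the fusion center receives the vector $\mathbf{X}_n=(X_n^{(a)})_{a\in\mathcal{A}_n}$. Given $O=o_m$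 and $R_n=r$, the $X_n^{(a)}$ are independent across sensors and independent of all previous observations, with $X_n^{(a)}$ having known density $f_1^{(a,o_m)}$ if $\|a-o_m\|<r$ and known density $f_0$ otherwise. The information at time $n$ is $I_n=(\mathbf{X}_1,\dots,\mathbf{X}_n)$, with $I_0$ empty. Posterior and false alarm. $\pi_{n,0}=\mathbb{P}(R_n=0\mid I_n)=\mathbb{P}(t>n\mid I_n)$. For a stopping time $T$, $\mathrm{PFA}(T)=\mathbb{P}(T<t)$. *)

theory Defs
  imports "HOL-Probability.Probability"
begin

definition is_density :: "(real \<Rightarrow> real) \<Rightarrow> bool" where
  "is_density f \<longleftrightarrow> f \<in> borel_measurable borel \<and> (\<forall>x. 0 \<le> f x) \<and>
     (\<integral>\<^sup>+ x. ennreal (f x) \<partial>lborel) = 1"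

text \<open>For open \<open>S\<close>, covering by open or by closed balls gives the same radius.\<close>

definition cover_radius :: "(real^2) set \<Rightarrow> (real^2) set \<Rightarrow> nat" where
  "cover_radius S Src = (LEAST r. 1 \<le> r \<and> (\<forall>c\<in>Src. S \<subseteq> ball c (real r)))"

definition obs ::
  "(nat \<Rightarrow> (real^2) set) \<Rightarrow> (nat \<Rightarrow> real^2 \<Rightarrow> 'w \<Rightarrow> real) \<Rightarrow> nat \<Rightarrow> 'w \<Rightarrow> (real^2 \<Rightarrow> real)" where
  "obs A X n \<omega> = (\<lambda>a\<in>A n. X n a \<omega>)"

definition obs_space :: "(nat \<Rightarrow> (real^2) set) \<Rightarrow> nat \<Rightarrow> (real^2 \<Rightarrow> real) measure" where
  "obs_space A n = (\<Pi>\<^sub>M a\<in>A n. borel)"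

definition info ::
  "(nat \<Rightarrow> (real^2) set) \<Rightarrow> (nat \<Rightarrow> real^2 \<Rightarrow> 'w \<Rightarrow> real) \<Rightarrow> nat \<Rightarrow> 'w \<Rightarrow> (nat \<Rightarrow> real^2 \<Rightarrow> real)" where
  "info A X n \<omega> = (\<lambda>k\<in>{1..n}. obs A X k \<omega>)"

definition info_space :: "(nat \<Rightarrow> (real^2) set) \<Rightarrow> nat \<Rightarrow> (nat \<Rightarrow> real^2 \<Rightarrow> real) measure" where
  "info_space A n = (\<Pi>\<^sub>M k\<in>{1..n}. obs_space A k)"

text \<open>Independence of random variables of different types, which the homogeneous library constant
  does not cover: independence of the generated sigma-algebras.\<close>

definition indep_rv ::
  "'w measure \<Rightarrow> 'b measure \<Rightarrow> ('w \<Rightarrow> 'b) \<Rightarrow> 'c measure \<Rightarrow> ('w \<Rightarrow> 'c) \<Rightarrow> bool" where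
  "indep_rv P M Y N Z \<longleftrightarrow> Y \<in> P \<rightarrow>\<^sub>M M \<and> Z \<in> P \<rightarrow>\<^sub>M N \<and>
     prob_space.indep_set P {Y -` B \<inter> space P | B. B \<in> sets M} {Z -` C \<inter> space P | C. C \<in> sets N}"

text \<open>The law \<open>\<P>(\<cdot> | Loc = c, R\<^sub>n = r)\<close>; used only when the conditioning event has positive
  probability.\<close>

definition cond_law ::
  "'w measure \<Rightarrow> ('w \<Rightarrow> real^2) \<Rightarrow> (nat \<Rightarrow> 'w \<Rightarrow> nat) \<Rightarrow> nat \<Rightarrow> real^2 \<Rightarrow> nat \<Rightarrow> 'w measure" where
  "cond_law P Loc R n c r = uniform_measure P {\<omega>\<in>space P. Loc \<omega> = c \<and> R n \<omega> = r}"

text \<open>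
  \<open>S\<close>: domain; \<open>Src\<close>: possible source locations; \<open>Loc\<close>: random source location;
  \<open>t\<close>: change point; \<open>\<rho>\<close>: its geometric parameter; \<open>R\<close>: radius process; \<open>\<rho>1\<close>: its growth
  probability; \<open>A n\<close>: sensors at time \<open>n\<close>; \<open>X n a\<close>: observation of sensor \<open>a\<close> at time \<open>n\<close>;
  \<open>f1 a c\<close> and \<open>f0\<close>: densities at sensor \<open>a\<close> when it is, or is not, reached from source \<open>c\<close>.
  The observation data \<open>A\<close> and \<open>X\<close> are relevant at times \<open>n \<ge> 1\<close> only.
\<close>

locale spreading_event = prob_space P
  for P :: "'w measure"
  and S :: "(real^2) set"
  and Src :: "(real^2) set"
  and Loc :: "'w \<Rightarrow> real^2"
  and t :: "'w \<Rightarrow> nat"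
  and \<rho> :: real
  and R :: "nat \<Rightarrow> 'w \<Rightarrow> nat"
  and \<rho>1 :: real
  and A :: "nat \<Rightarrow> (real^2) set"
  and X :: "nat \<Rightarrow> real^2 \<Rightarrow> 'w \<Rightarrow> real"
  and f0 :: "real \<Rightarrow> real"
  and f1 :: "real^2 \<Rightarrow> real^2 \<Rightarrow> real \<Rightarrow> real" +
  assumes domain: "open S" "connected S" "bounded S"
    and sources: "Src \<subseteq> S" "finite Src" "Src \<noteq> {}"
    and Loc_measurable: "Loc \<in> P \<rightarrow>\<^sub>M count_space Src"
    and Loc_uniform: "\<And>c. c \<in> Src \<Longrightarrow> \<P>(\<omega> in P. Loc \<omega> = c) = 1 / real (card Src)"
    and rho: "0 < \<rho>" "\<rho> < 1"
    and t_measurable: "t \<in> P \<rightarrow>\<^sub>M count_space UNIV"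
    and t_geometric: "\<And>m. \<P>(\<omega> in P. t \<omega> = m) = \<rho> * (1 - \<rho>) ^ m"
    and t_indep_Loc: "indep_rv P (count_space UNIV) t (count_space Src) Loc"
    and rho1: "0 < \<rho>1" "\<rho>1 \<le> 1"
    and R_measurable: "\<And>n. R n \<in> P \<rightarrow>\<^sub>M count_space {..cover_radius S Src}"
    and R_before: "AE \<omega> in P. \<forall>n < t \<omega>. R n \<omega> = 0"
    and R_change: "AE \<omega> in P. R (t \<omega>) \<omega> = 1"
    and R_grow: "\<And>n r. 1 \<le> r \<Longrightarrow> r < cover_radius S Src \<Longrightarrow> 0 < \<P>(\<omega> in P. R n \<omega> = r) \<Longrightarrow>
        \<P>(\<omega> in P. R (Suc n) \<omega> = r + 1 \<bar> R n \<omega> = r) = \<rho>1"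
    and R_stay: "\<And>n r. 1 \<le> r \<Longrightarrow> r < cover_radius S Src \<Longrightarrow> 0 < \<P>(\<omega> in P. R n \<omega> = r) \<Longrightarrow>
        \<P>(\<omega> in P. R (Suc n) \<omega> = r \<bar> R n \<omega> = r) = 1 - \<rho>1"
    and R_absorb: "AE \<omega> in P. \<forall>n. R n \<omega> = cover_radius S Src \<longrightarrow> R (Suc n) \<omega> = cover_radius S Src"
    and R_markov: "\<And>n (h :: nat \<Rightarrow> nat) s. 0 < \<P>(\<omega> in P. \<forall>i\<le>n. R i \<omega> = h i) \<Longrightarrow>
        \<P>(\<omega> in P. R (Suc n) \<omega> = s \<bar> \<forall>i\<le>n. R i \<omega> = h i) =
        \<P>(\<omega> in P. R (Suc n) \<omega> = s \<bar> R n \<omega> = h n)"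
    and R_indep_Loc: "indep_rv P (\<Pi>\<^sub>M n\<in>UNIV. count_space UNIV) (\<lambda>\<omega> n. R n \<omega>) (count_space Src) Loc"
    and sensors: "\<And>n. 1 \<le> n \<Longrightarrow> finite (A n)" "\<And>n. 1 \<le> n \<Longrightarrow> A n \<subseteq> S"
    and density_f0: "is_density f0"
    and density_f1: "\<And>n a c. 1 \<le> n \<Longrightarrow> a \<in> A n \<Longrightarrow> c \<in> Src \<Longrightarrow> is_density (f1 a c)"
    and X_measurable: "\<And>n a. 1 \<le> n \<Longrightarrow> a \<in> A n \<Longrightarrow> X n a \<in> borel_measurable P"
    and X_indep_sensors: "\<And>n c r. 1 \<le> n \<Longrightarrow> c \<in> Src \<Longrightarrow>
        0 < \<P>(\<omega> in P. Loc \<omega> = c \<and> R n \<omega> = r) \<Longrightarrow>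
        prob_space.indep_vars (cond_law P Loc R n c r) (\<lambda>_. borel) (X n) (A n)"
    and X_indep_past: "\<And>n c r. 1 \<le> n \<Longrightarrow> c \<in> Src \<Longrightarrow>
        0 < \<P>(\<omega> in P. Loc \<omega> = c \<and> R n \<omega> = r) \<Longrightarrow>
        indep_rv (cond_law P Loc R n c r)
          (obs_space A n) (obs A X n) (info_space A (n - 1)) (info A X (n - 1))"
    and X_density: "\<And>n c r a. 1 \<le> n \<Longrightarrow> c \<in> Src \<Longrightarrow> a \<in> A n \<Longrightarrow>
        0 < \<P>(\<omega> in P. Loc \<omega> = c \<and> R n \<omega> = r) \<Longrightarrow>
        distributed (cond_law P Loc R n c r) lborel (X n a)
          (\<lambda>x. ennreal (if norm (a - c) < real r then f1 a c x else f0 x))"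

text \<open>The sigma-algebra generated by the information at time \<open>n\<close>; trivial for \<open>n = 0\<close>.\<close>

definition info_algebra ::
  "'w measure \<Rightarrow> (nat \<Rightarrow> (real^2) set) \<Rightarrow> (nat \<Rightarrow> real^2 \<Rightarrow> 'w \<Rightarrow> real) \<Rightarrow> nat \<Rightarrow> 'w measure" where
  "info_algebra P A X n = vimage_algebra (space P) (info A X n) (info_space A n)"

definition posterior_zero ::
  "'w measure \<Rightarrow> (nat \<Rightarrow> 'w \<Rightarrow> nat) \<Rightarrow> (nat \<Rightarrow> (real^2) set) \<Rightarrow>
    (nat \<Rightarrow> real^2 \<Rightarrow> 'w \<Rightarrow> real) \<Rightarrow> nat \<Rightarrow> 'w \<Rightarrow> real" where
  "posterior_zero P R A X n =
     real_cond_exp P (info_algebra P A X n) (indicator {\<omega>\<in>space P. R n \<omega> = 0})"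

text \<open>The infimum in \<^typ>\<open>enat\<close> of the empty set is \<open>\<infinity>\<close>.\<close>

definition threshold_time ::
  "'w measure \<Rightarrow> (nat \<Rightarrow> 'w \<Rightarrow> nat) \<Rightarrow> (nat \<Rightarrow> (real^2) set) \<Rightarrow>
    (nat \<Rightarrow> real^2 \<Rightarrow> 'w \<Rightarrow> real) \<Rightarrow> real \<Rightarrow> 'w \<Rightarrow> enat" where
  "threshold_time P R A X Q \<omega> = Inf {enat n | n. posterior_zero P R A X n \<omega> \<le> Q}"

definition PFA :: "'w measure \<Rightarrow> ('w \<Rightarrow> nat) \<Rightarrow> ('w \<Rightarrow> enat) \<Rightarrow> real" where
  "PFA P t T = \<P>(\<omega> in P. T \<omega> < enat (t \<omega>))"

end

theory Submission
  imports Defs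
begin

text \<open>
  Split the false alarm event according to the value \<open>n\<close> of the threshold time. The event that the
  posterior of no change first drops to level \<open>Q\<close> at time \<open>n\<close> is decided by the information at
  time \<open>n\<close>, because the information accumulates (\<open>subalgebra_info_algebra_mono\<close>). On an event of
  that sigma-algebra the posterior may replace the indicator of \<open>R\<^sub>n = 0\<close> under the expectation,
  and there the posterior is at most \<open>Q\<close>. A false alarm at time \<open>n\<close> means \<open>n < t\<close>, hence
  \<open>R\<^sub>n = 0\<close> almost surely, so the part of the false alarm event with threshold time \<open>n\<close> has
  probability at most \<open>Q\<close> times the probability that the threshold time is \<open>n\<close>. Summed over \<open>n\<close>
  these bounds give at most \<open>Q\<close>.

  The argument concerns any filtration, any events in place of \<open>R\<^sub>n = 0\<close> and their conditional
  probabilities; it is stated in that form in \<open>prob_first_passage_cond_prob_le\<close>.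
\<close>

definition first_below :: "'w set \<Rightarrow> (nat \<Rightarrow> 'w \<Rightarrow> real) \<Rightarrow> real \<Rightarrow> nat \<Rightarrow> 'w set" where
  "first_below \<Omega> p Q n = {\<omega>\<in>\<Omega>. p n \<omega> \<le> Q \<and> (\<forall>m<n. Q < p m \<omega>)}"

lemma disjoint_first_below: "disjoint_family (first_below \<Omega> p Q)"
  unfolding disjoint_family_on_def first_below_def
  by (auto simp: set_eq_iff) (metis leD linorder_neqE_nat)

text \<open>The defining property of the conditional probability, integrated over an event on which it is
  bounded by \<open>q\<close>.\<close>

lemma (in prob_space) prob_Int_le_cond_prob_bound:
  assumes G: "subalgebra M G"
    and D: "D \<in> sets G"
    and B: "B \<in> events"
    and bound: "\<And>\<omega>. \<omega> \<in> D \<Longrightarrow> real_cond_exp M G (indicator B) \<omega> \<le> q"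
  shows "prob (D \<inter> B) \<le> q * prob D"
proof -
  interpret finite_measure_subalgebra M G
    using G by unfold_locales
  let ?p = "real_cond_exp M G (indicator B)"
  have DM: "D \<in> events"
    using G D by (auto simp: subalgebra_def)
  have intB: "integrable M (indicator B :: 'a \<Rightarrow> real)"
    using B by (simp add: emeasure_eq_measure)
  have "prob (D \<inter> B) = (\<integral>\<omega>\<in>D. indicator B \<omega> \<partial>M)"
    using DM B by (simp add: set_lebesgue_integral_def indicator_inter_arith[symmetric])
  also have "\<dots> = (\<integral>\<omega>\<in>D. ?p \<omega> \<partial>M)"
    using intB D by (rule real_cond_exp_intA)
  also have "\<dots> \<le> (\<integral>\<omega>\<in>D. q \<partial>M)"
  proof (rule set_integral_mono)
    show "set_integrable M D ?p"
      unfolding set_integrable_def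
      by (intro integrable_mult_indicator DM real_cond_exp_int(1) intB)
    show "set_integrable M D (\<lambda>_. q)"
      unfolding set_integrable_def
      by (intro integrable_mult_indicator DM) simp
  qed (use bound in auto)
  also have "\<dots> = q * prob D"
    using DM by (simp add: set_lebesgue_integral_def)
  finally show ?thesis .
qed

text \<open>Since \<open>G\<close> is a filtration, the first-passage event at time \<open>n\<close> lies in \<open>G n\<close> although it depends
  on all earlier conditional probabilities as well; so \<open>prob_Int_le_cond_prob_bound\<close> applies to it.
  The first-passage events are disjoint, hence their probabilities sum to at most 1 and the bounds
  add up to at most \<open>Q\<close>.\<close>

lemma (in prob_space) prob_first_passage_cond_prob_le:
  assumes G: "\<And>n. subalgebra M (G n)"
    and mono: "\<And>m n. m \<le> n \<Longrightarrow> subalgebra (G n) (G m)"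
    and B: "\<And>n. B n \<in> events"
    and Q: "0 \<le> Q"
  shows "prob (\<Union>n. first_below (space M) (\<lambda>n. real_cond_exp M (G n) (indicator (B n))) Q n \<inter> B n)
    \<le> Q"
proof -
  define p where "p = (\<lambda>n. real_cond_exp M (G n) (indicator (B n)))"
  define D where "D = first_below (space M) p Q"
  have meas: "p m \<in> borel_measurable (G n)" if "m \<le> n" for m n
    unfolding p_def
    by (rule measurable_from_subalg[OF mono[OF that] borel_measurable_cond_exp])
  have DG: "D n \<in> sets (G n)" for n
  proof -
    have "{\<omega>\<in>space (G n). Q < p m \<omega>} \<in> sets (G n)" if "m \<in> {..<n}" for m
      using that by (intro borel_measurable_less meas) auto
    moreover have "{\<omega>\<in>space (G n). p n \<omega> \<le> Q} \<in> sets (G n)"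
      by (intro borel_measurable_le meas) auto
    ultimately have "{\<omega>\<in>space (G n). p n \<omega> \<le> Q} \<inter> {\<omega>\<in>space (G n). \<forall>m\<in>{..<n}. Q < p m \<omega>} \<in> sets (G n)"
      by (intro sets.Int sets.sets_Collect_finite_All) auto
    moreover have "space (G n) = space M"
      using G[of n] by (simp add: subalgebra_def)
    ultimately show ?thesis
      unfolding D_def first_below_def by (auto simp: Int_def elim: back_subst)
  qed
  have DM: "D n \<in> events" for n
    using DG[of n] G[of n] by (auto simp: subalgebra_def)
  have disj: "disjoint_family D"
    unfolding D_def by (rule disjoint_first_below)
  have sumD: "(\<lambda>n. prob (D n)) sums prob (\<Union>n. D n)"
    using DM disj by (intro finite_measure_UNION) auto
  have "disjoint_family (\<lambda>n. D n \<inter> B n)"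
    using disj unfolding disjoint_family_on_def by blast
  then have sumDB: "(\<lambda>n. prob (D n \<inter> B n)) sums prob (\<Union>n. D n \<inter> B n)"
    using DM B by (intro finite_measure_UNION) auto
  have le: "prob (D n \<inter> B n) \<le> Q * prob (D n)" for n
    by (rule prob_Int_le_cond_prob_bound[OF G DG B])
      (simp add: D_def first_below_def p_def)
  have "prob (\<Union>n. D n \<inter> B n) \<le> Q * prob (\<Union>n. D n)"
    by (rule sums_le[OF le sumDB sums_mult[OF sumD]])
  also have "\<dots> \<le> Q"
    using Q by (simp add: mult_left_le)
  finally show ?thesis
    by (simp add: D_def p_def)
qed

text \<open>Discarding the observations after time \<open>m\<close> is a measurable map of information vectors.\<close>

lemma subalgebra_info_algebra_mono:
  assumes "info A X n \<in> P \<rightarrow>\<^sub>M info_space A n" and "m \<le> n"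
  shows "subalgebra (info_algebra P A X n) (info_algebra P A X m)"
proof -
  have "info A X n \<in> info_algebra P A X n \<rightarrow>\<^sub>M info_space A n"
    unfolding info_algebra_def
    using assms(1) by (intro measurable_vimage_algebra1) (auto dest: measurable_space)
  moreover have "(\<lambda>x. restrict x {1..m}) \<in> info_space A n \<rightarrow>\<^sub>M info_space A m"
    unfolding info_space_def using assms(2) by (intro measurable_restrict_subset) auto
  ultimately have "(\<lambda>\<omega>. restrict (info A X n \<omega>) {1..m}) \<in> info_algebra P A X n \<rightarrow>\<^sub>M info_space A m"
    by (rule measurable_compose)
  moreover have "(\<lambda>\<omega>. restrict (info A X n \<omega>) {1..m}) = info A X m"
    using assms(2) by (auto simp: info_def fun_eq_iff)
  ultimately have "info A X m \<in> info_algebra P A X n \<rightarrow>\<^sub>M info_space A m"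
    by simp
  from sets_image_in_sets[OF _ this, of "space P"] show ?thesis
    by (simp add: subalgebra_def info_algebra_def)
qed

context spreading_event
begin

lemma measurable_info: "info A X n \<in> P \<rightarrow>\<^sub>M info_space A n"
  unfolding info_def info_space_def obs_def obs_space_def
  by (intro measurable_restrict X_measurable) auto

lemma subalgebra_info_algebra: "subalgebra P (info_algebra P A X n)"
  unfolding subalgebra_def info_algebra_def
  using sets_image_in_sets[OF refl measurable_info] by simp

text \<open>A false alarm at time \<open>n\<close> is a first passage at a time before the change, when the radius is
  still zero.\<close>

lemma PFA_threshold_time_le:
  assumes "0 \<le> Q"
  shows "PFA P t (threshold_time P R A X Q) \<le> Q"
proof -
  define B where "B n = {\<omega>\<in>space P. R n \<omega> = 0}" for n
  define D where "D = first_below (space P) (posterior_zero P R A X) Q"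
  have B: "B n \<in> events" for n
  proof -
    have "R n -` {0} \<inter> space P \<in> events"
      by (rule measurable_sets[OF R_measurable]) simp
    moreover have "R n -` {0} \<inter> space P = B n"
      by (auto simp: B_def)
    ultimately show ?thesis by simp
  qed
  have post: "posterior_zero P R A X = (\<lambda>n. real_cond_exp P (info_algebra P A X n) (indicator (B n)))"
    by (simp add: posterior_zero_def B_def fun_eq_iff)
  have D: "D n \<in> events" for n
  proof -
    have [measurable]: "posterior_zero P R A X m \<in> borel_measurable P" for m
      unfolding post by (rule borel_measurable_cond_exp2)
    show ?thesis unfolding D_def first_below_def by measurable
  qed
  have passage: "\<exists>n < t \<omega>. \<omega> \<in> D n"
    if dom: "\<omega> \<in> space P" and early: "threshold_time P R A X Q \<omega> < enat (t \<omega>)" for \<omega>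
  proof -
    let ?low = "\<lambda>n. posterior_zero P R A X n \<omega> \<le> Q"
    obtain k where k: "k < t \<omega>" "?low k"
      using early by (auto simp: threshold_time_def Inf_less_iff)
    have "?low (Least ?low)"
      using k(2) by (rule LeastI)
    moreover have "Q < posterior_zero P R A X m \<omega>" if "m < Least ?low" for m
      using not_less_Least[OF that] by simp
    moreover have "Least ?low < t \<omega>"
      using Least_le[of ?low, OF k(2)] k(1) by simp
    ultimately show ?thesis
      using dom by (auto simp: D_def first_below_def)
  qed
  have "PFA P t (threshold_time P R A X Q) \<le> prob (\<Union>n. D n \<inter> B n)"
    unfolding PFA_def
  proof (rule finite_measure_mono_AE)
    show "AE \<omega> in P. \<omega> \<in> {\<omega>\<in>space P. threshold_time P R A X Q \<omega> < enat (t \<omega>)} \<longrightarrow>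
        \<omega> \<in> (\<Union>n. D n \<inter> B n)"
      using R_before
    proof eventually_elim
      case (elim \<omega>)
      then show ?case using passage[of \<omega>] by (auto simp: B_def)
    qed
    show "(\<Union>n. D n \<inter> B n) \<in> events"
      using D B by auto
  qed
  also have "\<dots> \<le> Q"
    unfolding D_def post
    by (rule prob_first_passage_cond_prob_le[OF subalgebra_info_algebra
          subalgebra_info_algebra_mono[OF measurable_info] B assms])
  finally show ?thesis .
qed

end

theorem proposition2:
  fixes P :: "'w measure"
    and S Src :: "(real^2) set"
    and Loc :: "'w \<Rightarrow> real^2"
    and t :: "'w \<Rightarrow> nat"
    and R :: "nat \<Rightarrow> 'w \<Rightarrow> nat"
    and A :: "nat \<Rightarrow> (real^2) set"
    and X :: "nat \<Rightarrow> real^2 \<Rightarrow> 'w \<Rightarrow> real"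
    and f0 :: "real \<Rightarrow> real"
    and f1 :: "real^2 \<Rightarrow> real^2 \<Rightarrow> real \<Rightarrow> real"
    and \<rho> \<rho>1 Q :: real
  assumes "spreading_event P S Src Loc t \<rho> R \<rho>1 A X f0 f1"
    and "0 < Q" and "Q < 1"
  shows "PFA P t (threshold_time P R A X Q) \<le> Q"
proof -
  interpret spreading_event P S Src Loc t \<rho> R \<rho>1 A X f0 f1
    by fact
  show ?thesis
    using assms(2) by (intro PFA_threshold_time_le) simp
qed

end
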